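(* Let $F$ be a simple graph of order $n\ge 1$, let $V_k=\{v_1,\ldots,v_k\}$ be a subset of the vertex set of $F$, and let $H_v$ be a simple graph of order $m\ge 2$ with a specified vertex $v$ of degree $m-1$. Let $H_1=H_v-v$ be an $r_1$-regular graph, where $r_1\ge 1$. Let $\lambda\in\sigma(A(H_v))\setminus\{\alpha,\beta\}$, where $\alpha,\beta$ are the roots of the equation $x^2-r_1x-m+1=0$, and let $G=G[F,V_k,H_v]$. If $|V_k|=k$, then $\lambda\in\sigma(A(G))$ with multiplicity $k$. Moreover, the remaining $n+k$ $A$-eigenvalues of $G$ are independent of $H_v$.
   Context: All graphs are finite and simple. $A(X)$ denotes the adjacency matrix of a graph $X$; the $A$-eigenvalues of $X$ are the eigenvalues of $A(X)$, and $\sigma(A(X))$ is the spectrum of $A(X)$, consisting of all its eigenvalues. Under the stated hypotheses, $\sigma(A(H_v))=(\sigma(A(H_1))-\{r_1\})\cup\{\alpha,\beta\}$. Graph with $k$ pockets: $G[F,V_k,H_v]$ is the graph obtained by taking one copy of $F$ and $k$ vertex-disjoint copies of $H_v$, and then, for each $i=1,\ldots,k$, identifying the vertex $v$ of the $i$th copy of $H_v$ with the vertex $v_i$ of $F$. *)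

theory Defs
  imports
    "Jordan_Normal_Form.Char_Poly"
    "HOL-Computational_Algebra.Fundamental_Theorem_Algebra"
    "Graph_Theory.Digraph_Component"
    "Graph_Theory.Pair_Digraph"
begin

text \<open>
  A finite simple graph is a \<^term>\<open>pair_graph\<close>: its arcs form a finite, irreflexive, symmetric
  relation on the vertex set, every edge being represented by its two orientations.
\<close>

definition regular_graph :: "('a, 'b) pre_digraph \<Rightarrow> nat \<Rightarrow> bool" where
  "regular_graph G r \<longleftrightarrow> (\<forall>u \<in> verts G. out_degree G u = r)"

text \<open>
  Matrices are indexed by natural numbers, so the rows and columns need some numbering of the
  vertices. It is chosen arbitrarily; another choice only conjugates the adjacency matrix by a
  permutation matrix.
\<close>

definition vertex_list :: "'a pair_pre_digraph \<Rightarrow> 'a list" where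
  "vertex_list G = (SOME xs. distinct xs \<and> set xs = pverts G)"

definition adjacency_mat :: "'a pair_pre_digraph \<Rightarrow> complex mat" where
  "adjacency_mat G =
     (let xs = vertex_list G; n = length xs
      in mat n n (\<lambda>(i, j). if (xs ! i, xs ! j) \<in> parcs G then 1 else 0))"

text \<open>
  The spectrum is the multiset of all eigenvalues, each one as often as it is a root of the
  characteristic polynomial.
\<close>

definition A_spectrum :: "'a pair_pre_digraph \<Rightarrow> complex multiset" where
  "A_spectrum G = proots (char_poly (adjacency_mat G))"

text \<open>
  The vertex \<open>x\<close> of the \<open>i\<close>-th copy of \<open>H\<close>, after the specified vertex \<open>v\<close> of that copy has been
  identified with the vertex \<open>vs i\<close> of \<open>F\<close>.
\<close>

definition pocket_vertex :: "(nat \<Rightarrow> 'a) \<Rightarrow> 'b \<Rightarrow> nat \<Rightarrow> 'b \<Rightarrow> 'a + nat \<times> 'b" where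
  "pocket_vertex vs v i x = (if x = v then Inl (vs i) else Inr (i, x))"

definition pocket_graph ::
    "'a pair_pre_digraph \<Rightarrow> (nat \<Rightarrow> 'a) \<Rightarrow> nat \<Rightarrow> 'b pair_pre_digraph \<Rightarrow> 'b
      \<Rightarrow> ('a + nat \<times> 'b) pair_pre_digraph" where
  "pocket_graph F vs k H v =
     \<lparr> pverts = Inl ` pverts F \<union> (\<Union>i\<in>{1..k}. pocket_vertex vs v i ` pverts H),
       parcs = map_prod Inl Inl ` parcs F \<union>
         (\<Union>i\<in>{1..k}. map_prod (pocket_vertex vs v i) (pocket_vertex vs v i) ` parcs H) \<rparr>"

definition pocket :: "'b pair_pre_digraph \<Rightarrow> 'b \<Rightarrow> nat \<Rightarrow> nat \<Rightarrow> bool" where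
  "pocket H v m r \<longleftrightarrow>
     pair_graph H \<and> card (pverts H) = m \<and> v \<in> pverts H \<and>
     out_degree (with_proj H) v = m - 1 \<and>
     regular_graph (pre_digraph.del_vert (with_proj H) v) r"

end

theory Submission
  imports Defs
begin

text \<open>
  Put \<open>H\<^sub>1 = H - v\<close> and fix \<open>x \<noteq> r\<close>. Since \<open>H\<^sub>1\<close> is \<open>r\<close>-regular and \<open>v\<close> is adjacent to all of it,
  adding \<open>1/(x - r)\<close> times each column of a copy of \<open>H\<^sub>1\<close> in \<open>x I - A(G)\<close> to the column of the root of
  that copy makes the matrix block triangular, and merely lowers the diagonal entry of the root by
  \<open>(m - 1)/(x - r)\<close>. Hence the characteristic polynomial of \<open>G\<close> at \<open>x\<close> is that of \<open>H\<^sub>1\<close> to the power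
  \<open>k\<close>, times a factor \<open>T(x)\<close> in which \<open>H\<close> enters only through \<open>m\<close> and \<open>r\<close>. The case of a single root
  relates \<open>H\<close> to \<open>H\<^sub>1\<close>, and the same elimination, applied to the quotient of \<open>G\<close> of order \<open>n + k\<close>,
  identifies \<open>(x - r)\<^sup>k T(x)\<close> as a characteristic polynomial.
\<close>

section \<open>Matrices indexed by lists of labels\<close>

text \<open>Rows and columns carry labels instead of numbers, so splitting a list of vertices splits
  the matrix into blocks.\<close>

definition list_mat :: "('a \<Rightarrow> 'b \<Rightarrow> 'c) \<Rightarrow> 'a list \<Rightarrow> 'b list \<Rightarrow> 'c mat" where
  "list_mat f xs ys = mat (length xs) (length ys) (\<lambda>(i, j). f (xs ! i) (ys ! j))"

lemma list_mat_carrier [simp]: "list_mat f xs ys \<in> carrier_mat (length xs) (length ys)"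
  by (simp add: list_mat_def)

lemma dim_list_mat [simp]:
  "dim_row (list_mat f xs ys) = length xs" "dim_col (list_mat f xs ys) = length ys"
  by (simp_all add: list_mat_def)

lemma list_mat_index [simp]:
  "i < length xs \<Longrightarrow> j < length ys \<Longrightarrow> list_mat f xs ys $$ (i, j) = f (xs ! i) (ys ! j)"
  by (simp add: list_mat_def)

lemma list_mat_cong:
  assumes "\<And>a b. a \<in> set xs \<Longrightarrow> b \<in> set ys \<Longrightarrow> f a b = g a b"
  shows "list_mat f xs ys = list_mat g xs ys"
  using assms by (intro eq_matI) auto

lemma list_mat_map: "list_mat f (map p xs) (map q ys) = list_mat (\<lambda>a b. f (p a) (q b)) xs ys"
  by (rule eq_matI) auto

lemma list_mat_append:
  "list_mat f (xs @ ys) (xs' @ ys') =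
    four_block_mat (list_mat f xs xs') (list_mat f xs ys') (list_mat f ys xs') (list_mat f ys ys')"
  by (rule eq_matI) (auto simp: nth_append)

lemma list_mat_zero [simp]: "list_mat (\<lambda>a b. 0) xs ys = 0\<^sub>m (length xs) (length ys)"
  by (rule eq_matI) auto

lemma list_mat_mult:
  assumes "distinct ys"
  shows "list_mat f xs ys * list_mat g ys zs = list_mat (\<lambda>a c. \<Sum>b\<in>set ys. f a b * g b c) xs zs"
proof (rule eq_matI)
  fix i j
  assume "i < dim_row (list_mat (\<lambda>a c. \<Sum>b\<in>set ys. f a b * g b c) xs zs)"
    and "j < dim_col (list_mat (\<lambda>a c. \<Sum>b\<in>set ys. f a b * g b c) xs zs)"
  moreover have "(\<Sum>b\<in>set ys. f a b * g b c) = (\<Sum>l = 0..<length ys. f a (ys ! l) * g (ys ! l) c)"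
    for a c
    using assms by (simp add: sum_list_distinct_conv_sum_set[symmetric] sum_list_sum_nth)
  ultimately show "(list_mat f xs ys * list_mat g ys zs) $$ (i, j) =
      list_mat (\<lambda>a c. \<Sum>b\<in>set ys. f a b * g b c) xs zs $$ (i, j)"
    by (simp add: scalar_prod_def)
qed auto

lemma list_mat_add: "list_mat f xs ys + list_mat g xs ys = list_mat (\<lambda>a b. f a b + g a b) xs ys"
  by (rule eq_matI) auto

text \<open>Reordering the labels permutes rows and columns alike, so the sign of the permutation
  enters twice. This makes the numbering of the vertices immaterial.\<close>

lemma det_list_mat_mset_cong:
  assumes "mset xs = mset ys"
  shows "det (list_mat f xs xs) = det (list_mat f ys ys)"
proof -
  let ?n = "length ys"
  obtain p where p: "p permutes {..<?n}" and xs: "permute_list p ys = xs"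
    using assms by (rule mset_eq_permutation)
  have p': "p permutes {0..<?n}" using p by (simp add: atLeast0LessThan)
  have len: "length xs = ?n" using xs by auto
  have nth: "xs ! i = ys ! p i" if "i < ?n" for i
    using permute_list_nth[OF p that] xs by simp
  have p_lt: "p i < ?n" if "i < ?n" for i
    using permutes_in_image[OF p, of i] that by simp
  define B where "B = mat ?n ?n (\<lambda>(i, j). list_mat f ys ys $$ (p i, j))"
  have B: "B \<in> carrier_mat ?n ?n" by (simp add: B_def)
  have "list_mat f xs xs = transpose_mat (mat ?n ?n (\<lambda>(i, j). transpose_mat B $$ (p i, j)))"
    by (rule eq_matI) (auto simp: len nth p_lt B_def)
  then have "det (list_mat f xs xs) = signof p * det B"
    using B by (simp add: det_transpose[of _ ?n] det_permute_rows[OF _ p', of "transpose_mat B"])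
  also have "det B = signof p * det (list_mat f ys ys)"
    unfolding B_def by (rule det_permute_rows[OF _ p']) simp
  finally show ?thesis
    by (simp add: sign_def split: if_splits)
qed

lemma det_list_mat_append:
  fixes f :: "'a \<Rightarrow> 'a \<Rightarrow> 'b :: idom"
  assumes "\<And>a b. a \<in> set ys \<Longrightarrow> b \<in> set xs \<Longrightarrow> f a b = 0"
  shows "det (list_mat f (xs @ ys) (xs @ ys)) = det (list_mat f xs xs) * det (list_mat f ys ys)"
proof -
  have "list_mat f ys xs = 0\<^sub>m (length ys) (length xs)"
    using assms by (subst list_mat_cong[where g = "\<lambda>a b. 0"]) auto
  then show ?thesis
    by (simp add: list_mat_append
        det_four_block_mat_lower_left_zero[of _ "length xs" _ "length ys"])
qed

text \<open>
  The Schur complement without inverses: adding combinations of the columns \<open>ys\<close> to the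
  columns \<open>xs\<close>, as prescribed by \<open>c\<close>, clears the lower left block.
\<close>

lemma det_list_mat_schur:
  fixes f :: "'a \<Rightarrow> 'a \<Rightarrow> 'b :: idom"
  assumes "distinct (xs @ ys)"
    and clear: "\<And>a b. a \<in> set ys \<Longrightarrow> b \<in> set xs \<Longrightarrow> (\<Sum>y\<in>set ys. f a y * c y b) = - f a b"
  shows "det (list_mat f (xs @ ys) (xs @ ys)) =
    det (list_mat (\<lambda>a b. f a b + (\<Sum>y\<in>set ys. f a y * c y b)) xs xs) * det (list_mat f ys ys)"
proof -
  let ?n = "length xs" and ?m = "length ys"
  \<comment> \<open>Right multiplication by \<open>?U\<close>, of determinant 1, performs the column
    operations.\<close>
  let ?U = "four_block_mat (1\<^sub>m ?n) (0\<^sub>m ?n ?m) (list_mat c ys xs) (1\<^sub>m ?m)"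
  let ?S = "\<lambda>a b. f a b + (\<Sum>y\<in>set ys. f a y * c y b)"
  have dist: "distinct ys" using assms(1) by simp
  have low: "list_mat ?S ys xs = 0\<^sub>m ?m ?n"
    using clear by (subst list_mat_cong[where g = "\<lambda>a b. 0"]) auto
  have "list_mat f (xs @ ys) (xs @ ys) * ?U =
    four_block_mat (list_mat ?S xs xs) (list_mat f xs ys) (0\<^sub>m ?m ?n) (list_mat f ys ys)"
    unfolding list_mat_append
    by (subst mult_four_block_mat[of _ ?n ?n _ ?m _ ?m _ _ ?n _ ?m])
       (simp_all add: list_mat_mult[OF dist] list_mat_add low)
  moreover have "det ?U = 1"
    by (subst det_four_block_mat_upper_right_zero[of _ ?n _ ?m]) auto
  moreover have "det (list_mat f (xs @ ys) (xs @ ys) * ?U) =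
      det (list_mat f (xs @ ys) (xs @ ys)) * det ?U"
    by (rule det_mult[of _ "?n + ?m"]) (rule carrier_matI; simp)+
  ultimately show ?thesis
    by (simp add: det_four_block_mat_lower_left_zero[of _ ?n _ ?m])
qed

text \<open>The matrix is block diagonal with one block \<open>h\<close> per index; the induction
  splits off the first block.\<close>

lemma det_list_mat_product:
  fixes f :: "'i \<times> 'a \<Rightarrow> 'i \<times> 'a \<Rightarrow> 'b :: idom"
  assumes "distinct is"
    and "\<And>i j y z. i \<in> set is \<Longrightarrow> j \<in> set is \<Longrightarrow> y \<in> set hs \<Longrightarrow> z \<in> set hs \<Longrightarrow>
      f (i, y) (j, z) = (if i = j then h y z else 0)"
  shows "det (list_mat f (List.product is hs) (List.product is hs)) =
    det (list_mat h hs hs) ^ length is"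
  using assms
proof (induction "is")
  case Nil
  then show ?case by (simp add: list_mat_def)
next
  case (Cons i "is")
  have "det (list_mat f (List.product (i # is) hs) (List.product (i # is) hs)) =
      det (list_mat f (map (Pair i) hs) (map (Pair i) hs)) *
      det (list_mat f (List.product is hs) (List.product is hs))"
    unfolding List.product.simps using Cons.prems by (intro det_list_mat_append) auto
  also have "list_mat f (map (Pair i) hs) (map (Pair i) hs) = list_mat h hs hs"
    unfolding list_mat_map using Cons.prems by (intro list_mat_cong) auto
  also have "det (list_mat f (List.product is hs) (List.product is hs)) =
      det (list_mat h hs hs) ^ length is"
    using Cons.prems by (intro Cons.IH) auto
  finally show ?case by simp
qed

section \<open>Determinants in the presence of identical pockets\<close>

text \<open>The base comes first and the pockets follow copy by copy: the split fits the Schur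
  complement, and the pocket part is block diagonal.\<close>

definition pocket_list :: "'a list \<Rightarrow> nat \<Rightarrow> 'b list \<Rightarrow> ('a + nat \<times> 'b) list" where
  "pocket_list as k hs = map Inl as @ map Inr (List.product [1..<Suc k] hs)"

lemma distinct_pocket_list:
  "distinct as \<Longrightarrow> distinct hs \<Longrightarrow> distinct (pocket_list as k hs)"
  by (auto simp: pocket_list_def distinct_map distinct_product inj_on_def)

lemma length_pocket_list [simp]: "length (pocket_list as k hs) = length as + k * length hs"
  by (simp add: pocket_list_def)

text \<open>
  Since the rows of \<open>h\<close> sum to \<open>s\<close>, its inverse maps the all-ones vector to its multiple by
  \<open>1/s\<close>, so each pocket only perturbs the diagonal entry of its root.
\<close>

lemma det_pocket_list:
  fixes f :: "'a + nat \<times> 'b \<Rightarrow> 'a + nat \<times> 'b \<Rightarrow> 'c :: field"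
  assumes dist: "distinct as" "distinct hs"
    and inj: "inj_on vs {1..k}"
    and s: "s \<noteq> 0" "\<And>y. y \<in> set hs \<Longrightarrow> (\<Sum>z\<in>set hs. h y z) = s"
    and ur: "\<And>a i z. a \<in> set as \<Longrightarrow> i \<in> {1..k} \<Longrightarrow> z \<in> set hs \<Longrightarrow>
      f (Inl a) (Inr (i, z)) = (if a = vs i then - w else 0)"
    and ll: "\<And>b i y. b \<in> set as \<Longrightarrow> i \<in> {1..k} \<Longrightarrow> y \<in> set hs \<Longrightarrow>
      f (Inr (i, y)) (Inl b) = (if b = vs i then - 1 else 0)"
    and lr: "\<And>i j y z. i \<in> {1..k} \<Longrightarrow> j \<in> {1..k} \<Longrightarrow> y \<in> set hs \<Longrightarrow> z \<in> set hs \<Longrightarrow>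
      f (Inr (i, y)) (Inr (j, z)) = (if i = j then h y z else 0)"
  shows "det (list_mat f (pocket_list as k hs) (pocket_list as k hs)) =
    det (list_mat (\<lambda>a b. f (Inl a) (Inl b) -
      (if a = b \<and> a \<in> vs ` {1..k} then of_nat (length hs) * w / s else 0)) as as) *
    det (list_mat h hs hs) ^ k"
proof -
  let ?P = "List.product [1..<Suc k] hs"
  define c :: "'a + nat \<times> 'b \<Rightarrow> 'a + nat \<times> 'b \<Rightarrow> 'c" where
    "c = (\<lambda>p q. case p of Inl _ \<Rightarrow> 0 | Inr (i, y) \<Rightarrow> if q = Inl (vs i) then 1 / s else 0)"
  have c: "c (Inr (i, y)) (Inl b) = (if b = vs i then 1 / s else 0)" for i y b
    by (auto simp: c_def)
  have P: "set ?P = {1..k} \<times> set hs" by auto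
  have sum_P: "(\<Sum>p\<in>set (map Inr ?P). F p) = (\<Sum>i\<in>{1..k}. \<Sum>z\<in>set hs. F (Inr (i, z)))"
    for F :: "'a + nat \<times> 'b \<Rightarrow> 'c"
    by (simp only: set_map P) (simp add: sum.reindex sum.cartesian_product case_prod_unfold)
  \<comment> \<open>Row \<open>y\<close> of \<open>h\<close> sums to \<open>s\<close>, so the
    columns weighted by \<open>1 / s\<close> contribute 1 to the column of the root and cancel its
    entry \<open>- 1\<close>.\<close>
  have sum_lower: "(\<Sum>p\<in>set (map Inr ?P). f u p * c p q) = - f u q"
    if u: "u \<in> set (map Inr ?P)" and q: "q \<in> set (map Inl as)" for u q
  proof -
    obtain i y where u': "u = Inr (i, y)" "i \<in> {1..k}" "y \<in> set hs" using u by auto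
    obtain b where q': "q = Inl b" "b \<in> set as" using q by auto
    have "(\<Sum>p\<in>set (map Inr ?P). f u p * c p q) =
        (\<Sum>j\<in>{1..k}. \<Sum>z\<in>set hs. if i = j then h y z * (if b = vs i then 1 / s else 0) else 0)"
      unfolding sum_P using u' q' by (intro sum.cong refl) (auto simp: lr c)
    also have "\<dots> = (\<Sum>j\<in>{1..k}. if i = j
        then (\<Sum>z\<in>set hs. h y z) * (if b = vs i then 1 / s else 0) else 0)"
      by (intro sum.cong refl) (auto simp: sum_divide_distrib)
    also have "\<dots> = - f u q" using u' q' s by (simp add: ll)
    finally show ?thesis .
  qed
  have sum_upper: "(\<Sum>p\<in>set (map Inr ?P). f (Inl a) p * c p (Inl b)) =
      - (if a = b \<and> a \<in> vs ` {1..k} then of_nat (length hs) * w / s else 0)"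
    if "a \<in> set as" for a b
  proof -
    have "(\<Sum>p\<in>set (map Inr ?P). f (Inl a) p * c p (Inl b)) =
        (\<Sum>i\<in>{1..k}. \<Sum>z\<in>set hs. if a = vs i \<and> b = vs i then - w / s else 0)"
      unfolding sum_P using that by (intro sum.cong refl) (auto simp: ur c)
    also have "\<dots> = (\<Sum>i\<in>{1..k}. if a = vs i \<and> b = vs i then - (of_nat (length hs) * w / s) else 0)"
      using dist by (intro sum.cong refl) (simp add: distinct_card)
    also have "\<dots> = - (if a = b \<and> a \<in> vs ` {1..k} then of_nat (length hs) * w / s else 0)"
    proof (cases "a = b \<and> a \<in> vs ` {1..k}")
      case True
      then obtain i where i: "i \<in> {1..k}" "a = vs i" "b = vs i" by auto
      \<comment> \<open>By injectivity exactly one pocket hangs at \<open>a\<close>, so the sum over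
        the pockets collapses to its term.\<close>
      have "(a = vs j \<and> b = vs j) \<longleftrightarrow> j = i" if "j \<in> {1..k}" for j
        using i that inj by (auto dest: inj_onD)
      then have "(\<Sum>i\<in>{1..k}. if a = vs i \<and> b = vs i then - (of_nat (length hs) * w / s) else 0) =
          (\<Sum>j\<in>{1..k}. if j = i then - (of_nat (length hs) * w / s) else 0)"
        by (intro sum.cong refl) simp
      also have "\<dots> = - (of_nat (length hs) * w / s)" using i by simp
      finally show ?thesis unfolding if_P[OF True] .
    next
      case False
      then have *: "\<not> (a = vs i \<and> b = vs i)" if "i \<in> {1..k}" for i using that by auto
      show ?thesis
        unfolding if_not_P[OF False] minus_zero
        by (rule sum.neutral, rule ballI, rule if_not_P, rule *)
    qed
    finally show ?thesis .
  qed
  have "det (list_mat f (pocket_list as k hs) (pocket_list as k hs)) =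
      det (list_mat (\<lambda>a b. f a b + (\<Sum>p\<in>set (map Inr ?P). f a p * c p b)) (map Inl as) (map Inl as)) *
      det (list_mat f (map Inr ?P) (map Inr ?P))"
    unfolding pocket_list_def
  proof (rule det_list_mat_schur)
    show "distinct (map Inl as @ map Inr ?P)"
      using distinct_pocket_list[OF dist] by (simp add: pocket_list_def)
  qed (rule sum_lower)
  also have "list_mat (\<lambda>a b. f a b + (\<Sum>p\<in>set (map Inr ?P). f a p * c p b)) (map Inl as) (map Inl as) =
      list_mat (\<lambda>a b. f (Inl a) (Inl b) -
        (if a = b \<and> a \<in> vs ` {1..k} then of_nat (length hs) * w / s else 0)) as as"
    unfolding list_mat_map by (rule list_mat_cong) (simp only: sum_upper diff_conv_add_uminus)
  also have "det (list_mat f (map Inr ?P) (map Inr ?P)) = det (list_mat h hs hs) ^ k"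
    unfolding list_mat_map by (subst det_list_mat_product[where h = h]) (auto simp: lr not_less_eq_eq)
  finally show ?thesis .
qed

section \<open>Characteristic polynomials and adjacency matrices\<close>

text \<open>Distinct labels make equality of labels agree with equality of indices. Evaluating at a
  point \<open>x\<close> permits division by \<open>x - r\<close> later on.\<close>

lemma poly_char_poly_list_mat:
  fixes f :: "'a \<Rightarrow> 'a \<Rightarrow> 'b :: comm_ring_1"
  assumes "distinct xs"
  shows "poly (char_poly (list_mat f xs xs)) x =
    det (list_mat (\<lambda>a b. (if a = b then x else 0) - f a b) xs xs)"
  unfolding char_poly_def using assms
  by (intro poly_det_cong[where n = "length xs"])
     (auto simp: char_poly_matrix_def nth_eq_iff_index_eq)

definition arc_ind :: "'a pair_pre_digraph \<Rightarrow> 'a \<Rightarrow> 'a \<Rightarrow> complex" where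
  "arc_ind G u w = (if (u, w) \<in> parcs G then 1 else 0)"

lemma vertex_list:
  assumes "finite (pverts G)"
  shows "distinct (vertex_list G)" "set (vertex_list G) = pverts G"
proof -
  have "\<exists>xs. distinct xs \<and> set xs = pverts G"
    using finite_distinct_list[OF assms] by blast
  from someI_ex[OF this] show "distinct (vertex_list G)" "set (vertex_list G) = pverts G"
    by (simp_all add: vertex_list_def)
qed

lemma adjacency_mat_eq: "adjacency_mat G = list_mat (arc_ind G) (vertex_list G) (vertex_list G)"
  by (simp add: adjacency_mat_def list_mat_def arc_ind_def Let_def)

text \<open>\<open>vertex_list\<close> is an arbitrary choice, but all duplicate-free enumerations
  share one multiset.\<close>

lemma poly_char_poly_adjacency:
  assumes "distinct xs" "set xs = pverts G"
  shows "poly (char_poly (adjacency_mat G)) x =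
    det (list_mat (\<lambda>a b. (if a = b then x else 0) - arc_ind G a b) xs xs)"
proof -
  have "finite (pverts G)" by (simp flip: assms(2))
  note vl = vertex_list[OF this]
  then have "mset (vertex_list G) = mset xs"
    using set_eq_iff_mset_eq_distinct[OF vl(1) assms(1)] assms(2) by simp
  then show ?thesis
    unfolding adjacency_mat_eq poly_char_poly_list_mat[OF vl(1)] by (rule det_list_mat_mset_cong)
qed

lemma char_poly_adjacency_nonzero: "char_poly (adjacency_mat G) \<noteq> 0"
proof -
  have "adjacency_mat G \<in> carrier_mat (length (vertex_list G)) (length (vertex_list G))"
    by (simp add: adjacency_mat_eq)
  then show ?thesis using degree_monic_char_poly by force
qed

section \<open>Combinatorics of pockets and of the pocket graph\<close>

lemma pocket_structure:
  assumes "pocket H v m r"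
  obtains hs where "distinct hs" "set hs = pverts H - {v}" "length hs = m - 1"
    "\<And>y. y \<in> set hs \<Longrightarrow> (v, y) \<in> parcs H" "\<And>y. y \<in> set hs \<Longrightarrow> (y, v) \<in> parcs H"
    "\<And>y. y \<in> set hs \<Longrightarrow> (\<Sum>z\<in>set hs. arc_ind H y z) = of_nat r"
proof -
  interpret pair_graph H using assms by (simp add: pocket_def)
  have v: "v \<in> pverts H" and m: "card (pverts H) = m"
    and deg: "out_degree (with_proj H) v = m - 1"
    and reg: "regular_graph (pre_digraph.del_vert (with_proj H) v) r"
    using assms by (auto simp: pocket_def)
  obtain hs where hs: "distinct hs" "set hs = pverts H - {v}"
    using finite_distinct_list[of "pverts H - {v}"] pair_finite_verts by auto
  have card: "card (pverts H - {v}) = m - 1"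
    using v m pair_finite_verts by simp
  \<comment> \<open>Without loops \<open>v\<close> has only \<open>m - 1\<close> possible
    neighbours, and its degree is already \<open>m - 1\<close>.\<close>
  have neigh: "{y. (v, y) \<in> parcs H} = pverts H - {v}"
  proof (rule card_subset_eq)
    show "finite (pverts H - {v})" using pair_finite_verts by simp
    show "{y. (v, y) \<in> parcs H} \<subseteq> pverts H - {v}"
      using pair_no_loops[of "(v, v)"] by (auto dest: in_arcsD2)
    have "out_arcs (with_proj H) v = Pair v ` {y. (v, y) \<in> parcs H}"
      by (auto simp: out_arcs_def)
    then show "card {y. (v, y) \<in> parcs H} = card (pverts H - {v})"
      using deg card by (simp add: out_degree_def card_image inj_on_def)
  qed
  have sym: "(y, v) \<in> parcs H" if "(v, y) \<in> parcs H" for y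
    using pair_sym_arcs that by (auto simp: symmetric_def sym_def)
  have rows: "(\<Sum>z\<in>set hs. arc_ind H y z) = of_nat r" if "y \<in> set hs" for y
  proof -
    have "out_arcs (pre_digraph.del_vert (with_proj H) v) y =
        Pair y ` {z \<in> set hs. (y, z) \<in> parcs H}"
      using that hs(2) in_arcsD2 by (auto simp: out_arcs_def pre_digraph.del_vert_def)
    moreover have "out_degree (pre_digraph.del_vert (with_proj H) v) y = r"
      using reg that hs(2) by (auto simp: regular_graph_def pre_digraph.del_vert_def)
    ultimately have "card {z \<in> set hs. (y, z) \<in> parcs H} = r"
      by (simp add: out_degree_def card_image inj_on_def)
    then show ?thesis
      by (simp add: arc_ind_def sum.If_cases Int_def)
  qed
  show thesis
    using hs card neigh sym rows distinct_card[OF hs(1)] by (intro that[of hs]) auto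
qed

lemma mem_map_prod_image_iff:
  "e \<in> map_prod f g ` R \<longleftrightarrow> (\<exists>x y. (x, y) \<in> R \<and> e = (f x, g y))"
  by force

text \<open>A copy of \<open>H\<close> could join two \<open>Inl\<close> vertices only through a
  loop at \<open>v\<close>, since every other vertex of it becomes an \<open>Inr\<close>.\<close>

lemma pocket_graph_arcs:
  assumes "(v, v) \<notin> parcs H"
  shows "(Inl a, Inl b) \<in> parcs (pocket_graph F vs k H v) \<longleftrightarrow> (a, b) \<in> parcs F"
    and "(Inl a, Inr (i, z)) \<in> parcs (pocket_graph F vs k H v) \<longleftrightarrow>
      i \<in> {1..k} \<and> a = vs i \<and> z \<noteq> v \<and> (v, z) \<in> parcs H"
    and "(Inr (i, y), Inl b) \<in> parcs (pocket_graph F vs k H v) \<longleftrightarrow>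
      i \<in> {1..k} \<and> b = vs i \<and> y \<noteq> v \<and> (y, v) \<in> parcs H"
    and "(Inr (i, y), Inr (j, z)) \<in> parcs (pocket_graph F vs k H v) \<longleftrightarrow>
      i \<in> {1..k} \<and> i = j \<and> y \<noteq> v \<and> z \<noteq> v \<and> (y, z) \<in> parcs H"
proof -
  have parcs: "e \<in> parcs (pocket_graph F vs k H v) \<longleftrightarrow>
      (\<exists>a b. (a, b) \<in> parcs F \<and> e = (Inl a, Inl b)) \<or>
      (\<exists>i\<in>{1..k}. \<exists>y z. (y, z) \<in> parcs H \<and>
        e = (pocket_vertex vs v i y, pocket_vertex vs v i z))" for e
    by (simp add: pocket_graph_def mem_map_prod_image_iff)
  have pv: "Inl a = pocket_vertex vs v i x \<longleftrightarrow> x = v \<and> a = vs i"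
    "Inr (j, y) = pocket_vertex vs v i x \<longleftrightarrow> x \<noteq> v \<and> j = i \<and> y = x" for a i x j y
    by (auto simp: pocket_vertex_def)
  show "(Inl a, Inl b) \<in> parcs (pocket_graph F vs k H v) \<longleftrightarrow> (a, b) \<in> parcs F"
    using assms unfolding parcs by (auto simp: pv)
  show "(Inl a, Inr (i, z)) \<in> parcs (pocket_graph F vs k H v) \<longleftrightarrow>
      i \<in> {1..k} \<and> a = vs i \<and> z \<noteq> v \<and> (v, z) \<in> parcs H"
    unfolding parcs by (auto simp: pv)
  show "(Inr (i, y), Inl b) \<in> parcs (pocket_graph F vs k H v) \<longleftrightarrow>
      i \<in> {1..k} \<and> b = vs i \<and> y \<noteq> v \<and> (y, v) \<in> parcs H"
    unfolding parcs by (auto simp: pv)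
  show "(Inr (i, y), Inr (j, z)) \<in> parcs (pocket_graph F vs k H v) \<longleftrightarrow>
      i \<in> {1..k} \<and> i = j \<and> y \<noteq> v \<and> z \<noteq> v \<and> (y, z) \<in> parcs H"
    unfolding parcs by (auto simp: pv)
qed

section \<open>Characteristic polynomials of the quotient, the pocket graph and
  \<open>H\<close>\<close>

text \<open>
  The quotient matrix of the pocket graph that merges the vertices other than the root in each
  pocket; it carries the eigenvalues that do not depend on \<open>H\<close>.
\<close>

fun quotient_entry ::
    "'a pair_pre_digraph \<Rightarrow> (nat \<Rightarrow> 'a) \<Rightarrow> nat \<Rightarrow> nat \<Rightarrow> 'a + nat \<times> unit \<Rightarrow> 'a + nat \<times> unit \<Rightarrow> complex"
where
  "quotient_entry F vs m r (Inl a) (Inl b) = arc_ind F a b"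
| "quotient_entry F vs m r (Inl a) (Inr (i, _)) = (if a = vs i then of_nat (m - 1) else 0)"
| "quotient_entry F vs m r (Inr (i, _)) (Inl b) = (if b = vs i then 1 else 0)"
| "quotient_entry F vs m r (Inr (i, _)) (Inr (j, _)) = (if i = j then of_nat r else 0)"

definition quotient_mat ::
    "'a pair_pre_digraph \<Rightarrow> (nat \<Rightarrow> 'a) \<Rightarrow> nat \<Rightarrow> nat \<Rightarrow> nat \<Rightarrow> complex mat" where
  "quotient_mat F vs k m r = list_mat (quotient_entry F vs m r)
     (pocket_list (vertex_list F) k [()]) (pocket_list (vertex_list F) k [()])"

text \<open>At \<open>t = (m - 1) / (x - r)\<close> this is the factor \<open>T(x)\<close>, common
  to the pocket graph and its quotient.\<close>

definition rooted_det :: "'a pair_pre_digraph \<Rightarrow> (nat \<Rightarrow> 'a) \<Rightarrow> nat \<Rightarrow> complex \<Rightarrow> complex \<Rightarrow> complex" where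
  "rooted_det F vs k x t = det (list_mat (\<lambda>a b. (if a = b then x else 0) - arc_ind F a b -
     (if a = b \<and> a \<in> vs ` {1..k} then t else 0)) (vertex_list F) (vertex_list F))"

lemma quotient_mat_carrier:
  assumes "finite (pverts F)"
  shows "quotient_mat F vs k m r \<in> carrier_mat (card (pverts F) + k) (card (pverts F) + k)"
proof -
  have "length (vertex_list F) = card (pverts F)"
    using vertex_list[OF assms] by (metis distinct_card)
  then have "length (pocket_list (vertex_list F) k [()]) = card (pverts F) + k" by simp
  then show ?thesis unfolding quotient_mat_def by (metis list_mat_carrier)
qed

lemma poly_char_poly_quotient:
  assumes "finite (pverts F)" "inj_on vs {1..k}" "x \<noteq> of_nat r"
  shows "poly (char_poly (quotient_mat F vs k m r)) x =
    rooted_det F vs k x (of_nat (m - 1) / (x - of_nat r)) * (x - of_nat r) ^ k"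
proof -
  let ?f = "\<lambda>a b. (if a = b then x else 0) - quotient_entry F vs m r a b"
  let ?h = "\<lambda>_ _ :: unit. x - of_nat r"
  have "poly (char_poly (quotient_mat F vs k m r)) x =
      det (list_mat ?f (pocket_list (vertex_list F) k [()]) (pocket_list (vertex_list F) k [()]))"
    unfolding quotient_mat_def using vertex_list[OF assms(1)]
    by (intro poly_char_poly_list_mat distinct_pocket_list) auto
  \<comment> \<open>Here \<open>length hs = 1\<close> and \<open>w = m - 1\<close>; in the pocket
    graph it is the other way round, so the diagonal entries of the roots change by the same
    amount.\<close>
  also have "\<dots> = det (list_mat (\<lambda>a b. ?f (Inl a) (Inl b) -
      (if a = b \<and> a \<in> vs ` {1..k}
       then of_nat (length [()]) * of_nat (m - 1) / (x - of_nat r) else 0))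
      (vertex_list F) (vertex_list F)) * det (list_mat ?h [()] [()]) ^ k"
    using vertex_list[OF assms(1)] assms(2,3) by (intro det_pocket_list) auto
  also have "det (list_mat ?h [()] [()]) = x - of_nat r"
    by (subst det_single) (auto simp: list_mat_def)
  finally show ?thesis by (simp add: rooted_det_def cong: if_cong)
qed

text \<open>The witness for \<open>d\<close> evaluates the characteristic polynomial of
  \<open>H - v\<close>. Both equations share it, so that it can be eliminated in favour of the
  spectrum of \<open>H\<close>.\<close>

lemma poly_char_poly_pocket_graph:
  fixes F :: "'a pair_pre_digraph" and H :: "'b pair_pre_digraph"
  assumes F: "finite (pverts F)" and vs: "inj_on vs {1..k}" "vs ` {1..k} \<subseteq> pverts F"
    and H: "pocket H v m r"
  shows "\<exists>d. \<forall>x. x \<noteq> of_nat r \<longrightarrow>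
    poly (char_poly (adjacency_mat (pocket_graph F vs k H v))) x =
      rooted_det F vs k x (of_nat (m - 1) / (x - of_nat r)) * d x ^ k \<and>
    poly (char_poly (adjacency_mat H)) x = (x - of_nat (m - 1) / (x - of_nat r)) * d x"
proof -
  interpret H: pair_graph H using H by (simp add: pocket_def)
  have v: "v \<in> pverts H" using H by (simp add: pocket_def)
  have loop: "(v, v) \<notin> parcs H" using H.pair_no_loops[of "(v, v)"] by auto
  obtain hs where hs: "distinct hs" "set hs = pverts H - {v}" "length hs = m - 1"
    and adj: "\<And>y. y \<in> set hs \<Longrightarrow> (v, y) \<in> parcs H" "\<And>y. y \<in> set hs \<Longrightarrow> (y, v) \<in> parcs H"
    and rows: "\<And>y. y \<in> set hs \<Longrightarrow> (\<Sum>z\<in>set hs. arc_ind H y z) = of_nat r"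
    by (rule pocket_structure[OF H]) blast
  let ?G = "pocket_graph F vs k H v"
  define h where "h = (\<lambda>x y z. (if y = z then x else 0) - arc_ind H y z)"
  \<comment> \<open>This is the \<open>s\<close> of \<open>det_pocket_list\<close>; it vanishes only
    at \<open>x = r\<close>, which is why that point is excluded.\<close>
  have h_rows: "(\<Sum>z\<in>set hs. h x y z) = x - of_nat r" if "y \<in> set hs" for x y
    using that rows by (simp add: h_def sum_subtractf)
  have "poly (char_poly (adjacency_mat ?G)) x =
      rooted_det F vs k x (of_nat (m - 1) / (x - of_nat r)) * det (list_mat (h x) hs hs) ^ k"
    if x: "x \<noteq> of_nat r" for x
  proof -
    let ?f = "\<lambda>a b. (if a = b then x else 0) - arc_ind ?G a b"
    let ?xs = "pocket_list (vertex_list F) k hs"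
    have pv: "pocket_vertex vs v i ` pverts H = insert (Inl (vs i)) (Inr ` ({i} \<times> set hs))" for i
    proof -
      have "pverts H = insert v (set hs)" "v \<notin> set hs" using hs(2) v by auto
      then show ?thesis by (auto simp: pocket_vertex_def)
    qed
    have "set ?xs = Inl ` pverts F \<union> Inr ` ({1..k} \<times> set hs)"
      by (simp add: pocket_list_def vertex_list(2)[OF F] atLeastLessThanSuc_atLeastAtMost
          del: upt_Suc)
    also have "\<dots> = pverts ?G"
      using vs(2) unfolding pocket_graph_def pair_pre_digraph.simps pv by blast
    finally have "poly (char_poly (adjacency_mat ?G)) x = det (list_mat ?f ?xs ?xs)"
      using vertex_list[OF F] hs(1)
      by (intro poly_char_poly_adjacency distinct_pocket_list)
    also have "\<dots> = det (list_mat (\<lambda>a b. ?f (Inl a) (Inl b) -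
        (if a = b \<and> a \<in> vs ` {1..k} then of_nat (length hs) * 1 / (x - of_nat r) else 0))
        (vertex_list F) (vertex_list F)) * det (list_mat (h x) hs hs) ^ k"
      using vertex_list[OF F] hs vs(1) x h_rows adj
      by (intro det_pocket_list) (auto simp: arc_ind_def pocket_graph_arcs[OF loop] h_def)
    finally show ?thesis
      by (simp add: rooted_det_def hs(3) arc_ind_def pocket_graph_arcs[OF loop] cong: if_cong)
  qed
  moreover have "poly (char_poly (adjacency_mat H)) x =
      (x - of_nat (m - 1) / (x - of_nat r)) * det (list_mat (h x) hs hs)"
    if x: "x \<noteq> of_nat r" for x
  proof -
    \<comment> \<open>\<open>H\<close> is treated as one pocket attached to a single vertex of type
      \<open>unit\<close>; \<open>p\<close> translates these labels back to vertices of
      \<open>H\<close>.\<close>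
    define p where "p = case_sum (\<lambda>_ :: unit. v) (snd :: nat \<times> 'b \<Rightarrow> 'b)"
    let ?f = "\<lambda>a b. h x (p a) (p b)"
    have p: "map p (pocket_list [()] 1 hs) = v # hs"
      by (simp add: pocket_list_def p_def comp_def)
    have "poly (char_poly (adjacency_mat H)) x = det (list_mat (h x) (v # hs) (v # hs))"
      unfolding h_def using hs v by (intro poly_char_poly_adjacency) auto
    also have "\<dots> = det (list_mat ?f (pocket_list [()] 1 hs) (pocket_list [()] 1 hs))"
      unfolding p[symmetric] list_mat_map ..
    also have "\<dots> = det (list_mat (\<lambda>a b. ?f (Inl a) (Inl b) -
        (if a = b \<and> a \<in> (\<lambda>_. ()) ` {1..1::nat} then of_nat (length hs) * 1 / (x - of_nat r) else 0))
        [()] [()]) * det (list_mat (h x) hs hs) ^ 1"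
      using hs x h_rows adj
      by (intro det_pocket_list) (auto simp: arc_ind_def h_def p_def)
    also have "det (list_mat (\<lambda>a b. ?f (Inl a) (Inl b) -
        (if a = b \<and> a \<in> (\<lambda>_. ()) ` {1..1::nat} then of_nat (length hs) * 1 / (x - of_nat r) else 0))
        [()] [()]) = x - of_nat (m - 1) / (x - of_nat r)"
      using loop hs(3) by (subst det_single) (auto simp: list_mat_def p_def h_def arc_ind_def)
    finally show ?thesis by simp
  qed
  ultimately show ?thesis by (intro exI[of _ "\<lambda>x. det (list_mat (h x) hs hs)"]) simp
qed

section \<open>From characteristic polynomials to multisets of eigenvalues\<close>

lemma sum_mset_replicate_mset: "(\<Sum>l\<in>#M. replicate_mset k l) = repeat_mset k M"
  by (induction M) (auto intro: multiset_eqI)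

text \<open>Vieta's formulas. Distinctness needs its own argument, as a set does not show
  multiplicities.\<close>

lemma quadratic_roots:
  fixes \<alpha> \<beta> :: complex
  assumes "{x :: complex. x ^ 2 - of_nat r * x - of_nat m + 1 = 0} = {\<alpha>, \<beta>}" and "m \<ge> 2"
  shows "\<alpha> \<noteq> \<beta>" "\<alpha> + \<beta> = of_nat r" "\<alpha> * \<beta> = - of_nat (m - 1)"
proof -
  have m: "of_nat m = (of_nat (m - 1) + 1 :: complex)" using assms(2) by (simp add: of_nat_diff)
  have root: "x = \<alpha> \<or> x = \<beta> \<longleftrightarrow> x * (x - of_nat r) = of_nat (m - 1)" for x
    using assms(1) unfolding set_eq_iff m by (simp add: power2_eq_square algebra_simps)
  \<comment> \<open>The reflection taking \<open>x\<close> to \<open>r - x\<close> preserves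
    \<open>x * (x - r)\<close> and so maps roots to roots.\<close>
  have "of_nat r - \<alpha> = \<alpha> \<or> of_nat r - \<alpha> = \<beta>"
    using root[of \<alpha>] root[of "of_nat r - \<alpha>"] by (simp add: algebra_simps)
  \<comment> \<open>A fixed point would be a double root, making the discriminant
    \<open>r ^ 2 + 4 * (m - 1)\<close> zero, although as a natural number it is positive.\<close>
  moreover have "of_nat r - \<alpha> \<noteq> \<alpha>"
  proof
    assume "of_nat r - \<alpha> = \<alpha>"
    then have r: "of_nat r = 2 * \<alpha>" by (simp add: algebra_simps)
    have "of_nat (m - 1) = - (\<alpha> * \<alpha>)"
      using root[of \<alpha>] by (simp add: r algebra_simps)
    moreover have "of_nat (r ^ 2 + 4 * (m - 1)) = (2 * \<alpha>) ^ 2 + 4 * of_nat (m - 1)"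
      using r by (simp only: of_nat_add of_nat_mult of_nat_power of_nat_numeral)
    ultimately have "of_nat (r ^ 2 + 4 * (m - 1)) = (0 :: complex)"
      by (simp add: power2_eq_square)
    then have "r ^ 2 + 4 * (m - 1) = 0" by (simp only: of_nat_eq_0_iff)
    then show False using assms(2) by simp
  qed
  ultimately have \<beta>: "\<beta> = of_nat r - \<alpha>" by simp
  then show "\<alpha> + \<beta> = of_nat r" by simp
  show "\<alpha> \<noteq> \<beta>" using \<beta> \<open>of_nat r - \<alpha> \<noteq> \<alpha>\<close> by simp
  show "\<alpha> * \<beta> = - of_nat (m - 1)" using root[of \<alpha>] by (simp add: \<beta> algebra_simps)
qed

text \<open>Eliminating \<open>d\<close> and \<open>T\<close> gives
  \<open>g * q ^ k = p ^ k * c\<close>, where \<open>g\<close>, \<open>p\<close>, \<open>c\<close>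
  belong to the pocket graph, \<open>H\<close> and the quotient, and \<open>q\<close> has the roots
  \<alpha> and \<beta>. It remains to compare root multisets and cancel \<open>k\<close> copies of
  these two roots.\<close>

lemma A_spectrum_pocket_graph:
  assumes F: "finite (pverts F)" and vs: "inj_on vs {1..k}" "vs ` {1..k} \<subseteq> pverts F"
    and H: "pocket H v m r" and m: "m \<ge> 2"
    and ab: "\<alpha> \<noteq> \<beta>" "\<alpha> + \<beta> = of_nat r" "\<alpha> * \<beta> = - of_nat (m - 1)"
  shows "A_spectrum (pocket_graph F vs k H v) =
    (\<Sum>l\<in>#A_spectrum H - {#\<alpha>, \<beta>#}. replicate_mset k l) + proots (char_poly (quotient_mat F vs k m r))"
proof -
  let ?G = "pocket_graph F vs k H v"
  define g where "g = char_poly (adjacency_mat ?G)"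
  define p where "p = char_poly (adjacency_mat H)"
  define c where "c = char_poly (quotient_mat F vs k m r)"
  define q where "q = [:-\<alpha>, 1:] * [:-\<beta>, 1:]"
  have nz: "g \<noteq> 0" "p \<noteq> 0"
    by (simp_all add: g_def p_def char_poly_adjacency_nonzero)
  have "c \<noteq> 0"
    using degree_monic_char_poly[OF quotient_mat_carrier[OF F, of vs k m r]]
    unfolding c_def by auto
  have q: "poly q x = x * (x - of_nat r) - of_nat (m - 1)" for x
  proof -
    have "of_nat (m - 1) = - (\<alpha> * \<beta>)" using ab(3) by simp
    then show ?thesis by (simp only: q_def flip: ab(2)) (simp add: algebra_simps)
  qed
  obtain d where g: "poly g x = rooted_det F vs k x (of_nat (m - 1) / (x - of_nat r)) * d x ^ k"
    and "poly p x = (x - of_nat (m - 1) / (x - of_nat r)) * d x" if "x \<noteq> of_nat r" for x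
    using poly_char_poly_pocket_graph[OF F vs H] unfolding g_def p_def by blast
  then have p: "poly p x * (x - of_nat r) = poly q x * d x" if "x \<noteq> of_nat r" for x
    using that by (simp add: q divide_simps)
  have "poly (g * q ^ k) x = poly (p ^ k * c) x" if x: "x \<noteq> of_nat r" for x
  proof -
    let ?T = "rooted_det F vs k x (of_nat (m - 1) / (x - of_nat r))"
    have "poly (g * q ^ k) x = ?T * (poly q x * d x) ^ k"
      by (simp add: g[OF x] power_mult_distrib)
    also have "\<dots> = poly (p ^ k * c) x"
      using poly_char_poly_quotient[OF F vs(1) x, of m]
      by (simp add: p[OF x, symmetric] c_def power_mult_distrib)
    finally show ?thesis .
  qed
  \<comment> \<open>The extra factor \<open>x - r\<close> makes both sides vanish at the excluded
    point and is cancelled afterwards.\<close>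
  then have "poly (g * q ^ k * [:- of_nat r, 1:]) x = poly (p ^ k * c * [:- of_nat r, 1:]) x" for x
    by (cases "x = of_nat r") (simp_all del: poly_mult add: poly_mult[of _ "[:_, 1:]"])
  then have "g * q ^ k * [:- of_nat r, 1:] = p ^ k * c * [:- of_nat r, 1:]"
    by (intro poly_ext)
  moreover have "[:- of_nat r, 1:] \<noteq> (0 :: complex poly)" by simp
  ultimately have "g * q ^ k = p ^ k * c" by (metis mult_right_cancel)
  then have "proots (g * q ^ k) = proots (p ^ k * c)" by simp
  moreover have "q \<noteq> 0" by (simp add: q_def)
  moreover have "proots q = {#\<alpha>, \<beta>#}"
    unfolding q_def by (subst proots_mult) auto
  ultimately have eq: "proots g + repeat_mset k {#\<alpha>, \<beta>#} = repeat_mset k (proots p) + proots c"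
    using nz \<open>c \<noteq> 0\<close> by (simp add: proots_mult proots_power)
  \<comment> \<open>At \<open>r\<close> the value of \<open>q\<close> is \<open>- (m - 1)\<close>,
    nonzero for \<open>m \<ge> 2\<close>; so roots of \<open>q\<close> avoid \<open>r\<close>, and
    the relation between \<open>p\<close> and \<open>q\<close> makes them roots of
    \<open>p\<close>.\<close>
  have root: "y \<in># proots p" if "poly q y = 0" for y
  proof -
    have "y \<noteq> of_nat r" using that m by (auto simp: q)
    then show ?thesis using p[of y] that nz(2) by simp
  qed
  have "{#\<alpha>, \<beta>#} \<subseteq># M" if "\<alpha> \<in># M" "\<beta> \<in># M" for M
    using that ab(1) by (auto simp: insert_subset_eq_iff in_diff_count)
  then have "{#\<alpha>, \<beta>#} \<subseteq># proots p"
    using root[of \<alpha>] root[of \<beta>] by (simp add: q_def)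
  then have le: "count {#\<alpha>, \<beta>#} l \<le> count (proots p) l" for l
    by (rule mset_subset_eq_count)
  \<comment> \<open>Multiset difference truncates; the bound \<open>le\<close> makes the subtraction
    of counts exact.\<close>
  have "proots g = repeat_mset k (proots p - {#\<alpha>, \<beta>#}) + proots c"
  proof (rule multiset_eqI)
    fix l
    have "count (proots g) l + k * count {#\<alpha>, \<beta>#} l = k * count (proots p) l + count (proots c) l"
      using arg_cong[OF eq, of "\<lambda>M. count M l"] by (simp only: count_union count_repeat_mset)
    then show "count (proots g) l =
        count (repeat_mset k (proots p - {#\<alpha>, \<beta>#}) + proots c) l"
      using mult_le_mono2[OF le[of l], of k]
      unfolding count_union count_repeat_mset count_diff diff_mult_distrib2 by linarith
  qed
  then show ?thesis
    by (simp only: A_spectrum_def sum_mset_replicate_mset g_def p_def c_def)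
qed

text \<open>\<open>R\<close> is the spectrum of the quotient matrix, built from \<open>F\<close>,
  \<open>vs\<close>, \<open>k\<close>, \<open>m\<close> and \<open>r1\<close> alone, hence the same
  for every pocket with these parameters.\<close>

theorem theorem3p2:
  fixes F :: "'a pair_pre_digraph" and vs :: "nat \<Rightarrow> 'a"
    and H :: "'b pair_pre_digraph" and v :: 'b
    and n m k r1 :: nat and \<alpha> \<beta> :: complex
  assumes "pair_graph F" and "card (pverts F) = n" and "n \<ge> 1"
    and "vs ` {1..k} \<subseteq> pverts F" and "card (vs ` {1..k}) = k"
    and "m \<ge> 2" and "r1 \<ge> 1" and "pocket H v m r1"
    and "{x :: complex. x ^ 2 - of_nat r1 * x - of_nat m + 1 = 0} = {\<alpha>, \<beta>}"
  shows "\<exists>R. size R = n + k \<and>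
    A_spectrum (pocket_graph F vs k H v) =
      (\<Sum>l\<in>#A_spectrum H - {#\<alpha>, \<beta>#}. replicate_mset k l) + R \<and>
    (\<forall>(H' :: 'c pair_pre_digraph) v'. pocket H' v' m r1 \<longrightarrow>
      A_spectrum (pocket_graph F vs k H' v') =
        (\<Sum>l\<in>#A_spectrum H' - {#\<alpha>, \<beta>#}. replicate_mset k l) + R)"
proof (intro exI conjI allI impI)
  interpret F: pair_graph F by fact
  note F = F.pair_finite_verts
  have inj: "inj_on vs {1..k}" using assms(5) by (intro eq_card_imp_inj_on) auto
  note roots = quadratic_roots[OF assms(9,6)]
  \<comment> \<open>This \<open>show\<close> also fixes the witness \<open>R\<close>; over the
    complex numbers the number of roots is the degree, here \<open>n + k\<close>.\<close>
  show "size (proots (char_poly (quotient_mat F vs k m r1))) = n + k"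
    using degree_monic_char_poly[OF quotient_mat_carrier[OF F]] assms(2)
    unfolding size_proots_complex by blast
  show "A_spectrum (pocket_graph F vs k H v) =
      (\<Sum>l\<in>#A_spectrum H - {#\<alpha>, \<beta>#}. replicate_mset k l) +
      proots (char_poly (quotient_mat F vs k m r1))"
    using F inj assms(4,8,6) roots by (rule A_spectrum_pocket_graph)
  show "A_spectrum (pocket_graph F vs k H' v') =
      (\<Sum>l\<in>#A_spectrum H' - {#\<alpha>, \<beta>#}. replicate_mset k l) +
      proots (char_poly (quotient_mat F vs k m r1))"
    if "pocket H' v' m r1" for H' :: "'c pair_pre_digraph" and v'
    using F inj assms(4) that assms(6) roots by (rule A_spectrum_pocket_graph)
qed

end
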